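(* Let $p$ be a prime and $n\ge 1$ an integer. (a) The $f$-vector of $X(\mathbb{F}_p^n)$ is given by $f_{-1}=1$ and $$f_i(X(\mathbb{F}_p^n))=\frac{(p^n-p^{i})\cdots(p^n-p^0)}{(i+1)!}\qquad (0\le i\le n-1).$$ (b) The $f$-vector of $K(\mathbb{F}_p^n)$ is given by $f_{-1}=1$ and $$f_i(K(\mathbb{F}_p^n))=\frac{(p^n-p^{i})\cdots(p^n-p^0)}{(p-1)^{i+1}(i+1)!}\qquad (0\le i\le n-1).$$ (c) Let $\sigma$ be an $m$-simplex in $X(\mathbb{F}_p^n)$. The $f$-vector of the link $\mathrm{Lk}_{X(\mathbb{F}_p^n)}(\sigma)$ is given by $f_{-1}=1$ and $$f_i(\mathrm{Lk}_{X(\mathbb{F}_p^n)}(\sigma))=\frac{(p^n-p^{m+1})\cdots(p^n-p^{m+i+1})}{(i+1)!}\qquad (0\le i\le n-m-2).$$ (d) Let $\sigma$ be an $m$-simplex in $K(\mathbb{F}_p^n)$. The $f$-vector of the link $\mathrm{Lk}_{K(\mathbb{F}_p^n)}(\sigma)$ is given by $f_{-1}=1$ and $$f_i(\mathrm{Lk}_{K(\mathbb{F}_p^n)}(\sigma))=\frac{(p^n-p^{m+1})\cdots(p^n-p^{m+i+1})}{(p-1)^{i+1}(i+1)!}\qquad (0\le i\le n-m-2).$$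
   Context: $X(\mathbb{F}_p^n)$ is the simplicial complex whose vertices are the nonzero vectors of $\mathbb{F}_p^n$ and whose simplices are the linearly independent subsets of $\mathbb{F}_p^n$ (including the empty set). $K(\mathbb{F}_p^n)$ is the simplicial complex whose vertices are the $1$-dimensional subspaces (lines) of $\mathbb{F}_p^n$ and whose simplices are the sets of lines $\{l_1,\dots,l_k\}$ spanning a $k$-dimensional subspace (including the empty set). An $i$-simplex (or $i$-face) is a simplex with $i+1$ vertices, and $f_i(\mathcal{L})$ denotes the number of $i$-faces of a simplicial complex $\mathcal{L}$, with $f_{-1}=1$ counting the empty face. The link of $\sigma\in\mathcal{L}$ is $\mathrm{Lk}_{\mathcal{L}}(\sigma)=\{\tau\in\mathcal{L}\mid \tau\cap\sigma=\emptyset,\ \tau\cup\sigma\in\mathcal{L}\}$. *)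

theory Defs
  imports "HOL-Analysis.Analysis" "Berlekamp_Zassenhaus.Finite_Field"
begin

text \<open>
  Simplicial complexes are abstract and given by their set of simplices, the empty simplex
  included. The dimension of a simplex is an integer, the empty simplex having dimension -1.
\<close>

definition is_face :: "'v set set \<Rightarrow> int \<Rightarrow> 'v set \<Rightarrow> bool" where
  "is_face L i \<sigma> \<longleftrightarrow> \<sigma> \<in> L \<and> finite \<sigma> \<and> int (card \<sigma>) = i + 1"

definition face_number :: "'v set set \<Rightarrow> int \<Rightarrow> nat" where
  "face_number L i = card {\<sigma>. is_face L i \<sigma>}"

definition link :: "'v set set \<Rightarrow> 'v set \<Rightarrow> 'v set set" where
  "link L \<sigma> = {\<tau> \<in> L. \<tau> \<inter> \<sigma> = {} \<and> \<tau> \<union> \<sigma> \<in> L}"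

definition independence_complex :: "('a::field ^ 'n) set set" where
  "independence_complex = {S. finite S \<and> vec.independent S}"

definition lines :: "('a::field ^ 'n) set set" where
  "lines = {l. vec.subspace l \<and> vec.dim l = 1}"

definition line_complex :: "('a::field ^ 'n) set set set" where
  "line_complex = {S. finite S \<and> S \<subseteq> lines \<and> vec.dim (vec.span (\<Union>S)) = card S}"

end

theory Submission
  imports Defs
begin

text \<open>
  In both complexes the number of vertices extending a simplex \<open>S\<close> depends only on the size \<open>k\<close> of
  \<open>S\<close>: one may add any vector, respectively any line, not contained in the \<open>k\<close>-dimensional span of
  \<open>S\<close>. This leaves \<open>p\<^sup>n - p\<^sup>k\<close> vectors and, since these are partitioned by the nonzero elements of
  the lines, \<open>(p\<^sup>n - p\<^sup>k) / (p - 1)\<close> lines. Counting ordered extensions of \<open>\<sigma>\<close> one vertex at a time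
  gives the \<open>f\<close>-vector of the link of \<open>\<sigma>\<close>; the whole complex is the link of the empty simplex.
\<close>

section \<open>Counting faces and link faces by one-vertex extensions\<close>

text \<open>Double count pairs of a face with \<open>i + 1\<close> vertices and one vertex
  \<open>v\<close> of it. Deleting \<open>v\<close> turns them into pairs of a face with
  \<open>i\<close> vertices and an extending vertex, so \<open>i + 1\<close> times the number of
  larger faces is \<open>c i\<close> times the number of smaller ones. The factors
  \<open>i + 1\<close> accumulate to the factorial.\<close>

lemma card_by_extensions:
  fixes L :: "'v::finite set set" and c :: "nat \<Rightarrow> real"
  assumes empty: "{} \<in> L"
    and closed: "\<And>S v. insert v S \<in> L \<Longrightarrow> S \<in> L"
    and ext: "\<And>S. S \<in> L \<Longrightarrow> real (card {v. v \<notin> S \<and> insert v S \<in> L}) = c (card S)"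
  shows "real (card {S \<in> L. card S = i}) * fact i = (\<Prod>j<i. c j)"
proof (induction i)
  case 0
  have "{S \<in> L. card S = 0} = {{}}"
    using empty by auto
  then show ?case by simp
next
  case (Suc i)
  let ?N = "\<lambda>i. {S \<in> L. card S = i}" and ?E = "\<lambda>S. {v. v \<notin> S \<and> insert v S \<in> L}"
  have "bij_betw (\<lambda>(S, v). (S - {v}, v)) (SIGMA S:?N (Suc i). S) (SIGMA S:?N i. ?E S)"
  proof (rule bij_betw_byWitness[where f' = "\<lambda>(S, v). (insert v S, v)"])
    show "(\<lambda>(S, v). (S - {v}, v)) ` (SIGMA S:?N (Suc i). S) \<subseteq> (SIGMA S:?N i. ?E S)"
    proof clarsimp
      fix S v
      assume "S \<in> L" "v \<in> S"
      then show "S - {v} \<in> L \<and> insert v S \<in> L"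
        using closed[of v "S - {v}"] by (simp add: insert_absorb)
    qed
  qed (auto simp: insert_absorb)
  then have "card (SIGMA S:?N (Suc i). S) = card (SIGMA S:?N i. ?E S)"
    by (rule bij_betw_same_card)
  then have "real (\<Sum>S\<in>?N (Suc i). card S) = real (\<Sum>S\<in>?N i. card (?E S))"
    by simp
  then have "real (card (?N (Suc i))) * real (Suc i) = real (card (?N i)) * c i"
    using ext by (simp add: algebra_simps)
  then have "real (card (?N (Suc i))) * fact (Suc i) = (real (card (?N i)) * fact i) * c i"
    by (simp del: of_nat_Suc)
  then show ?case
    using Suc.IH by simp
qed

text \<open>Removing the vertices of \<open>S\<close> one at a time upgrades closure under deleting
  a vertex to closure under passing to subsets.\<close>

lemma union_in_closed:
  fixes L :: "'v::finite set set"
  assumes closed: "\<And>S v. insert v S \<in> L \<Longrightarrow> S \<in> L" and "S \<union> T \<in> L"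
  shows "T \<in> L"
proof -
  have "finite S" by simp
  then show ?thesis
    using assms(2) by (induction S) (auto intro: closed)
qed

lemma link_empty [simp]: "link L {} = L"
  by (auto simp: link_def)

text \<open>A link inherits uniform extension counts: extending \<open>S\<close> in the link of
  \<sigma> is the same as extending the face \<open>\<sigma> \<union> S\<close> of \<open>L\<close>.
  The preceding count applies with \<open>c\<close> shifted by \<open>card \<sigma>\<close>.\<close>

lemma card_link_by_extensions:
  fixes L :: "'v::finite set set" and c :: "nat \<Rightarrow> real"
  assumes closed: "\<And>S v. insert v S \<in> L \<Longrightarrow> S \<in> L"
    and ext: "\<And>S. S \<in> L \<Longrightarrow> real (card {v. v \<notin> S \<and> insert v S \<in> L}) = c (card S)"
    and "\<sigma> \<in> L"
  shows "real (card {\<tau> \<in> link L \<sigma>. card \<tau> = i}) * fact i = (\<Prod>j<i. c (card \<sigma> + j))"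
proof (rule card_by_extensions)
  have sub: "T \<in> L" if "S \<in> L" "T \<subseteq> S" for S T
    using union_in_closed[of L S T] closed that by (simp add: Un_absorb2)
  show "{} \<in> link L \<sigma>"
    using \<open>\<sigma> \<in> L\<close> sub by (auto simp: link_def)
  show "S \<in> link L \<sigma>" if "insert v S \<in> link L \<sigma>" for S v
    using that closed by (auto simp: link_def)
  fix S
  assume S: "S \<in> link L \<sigma>"
  \<comment> \<open>From left to right, \<open>v\<close> avoids \<sigma> because link faces are
    disjoint from \<sigma>. From right to left, \<open>insert v S\<close> is a face as a subset of
    one.\<close>
  have "{v. v \<notin> S \<and> insert v S \<in> link L \<sigma>} = {v. v \<notin> \<sigma> \<union> S \<and> insert v (\<sigma> \<union> S) \<in> L}"
    using S sub[of "insert _ (\<sigma> \<union> S)" "insert _ S"]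
    by (fastforce simp: link_def Un_commute)
  moreover have "\<sigma> \<union> S \<in> L" "card (\<sigma> \<union> S) = card \<sigma> + card S"
    using S by (auto simp: link_def Un_commute card_Un_disjoint Int_commute)
  ultimately show "real (card {v. v \<notin> S \<and> insert v S \<in> link L \<sigma>}) = c (card \<sigma> + card S)"
    using ext[of "\<sigma> \<union> S"] by simp
qed

text \<open>Here \<open>q\<close> is the size of the field, \<open>n\<close> the dimension of the
  space and \<open>d\<close> the number of nonzero vectors representing one vertex: 1 for vectors,
  \<open>q - 1\<close> for lines.\<close>

locale uniform_extensions =
  fixes L :: "'v::finite set set" and n :: nat and q d :: real
  assumes closed: "insert v S \<in> L \<Longrightarrow> S \<in> L"
    and ext: "S \<in> L \<Longrightarrow>
      real (card {v. v \<notin> S \<and> insert v S \<in> L}) = (q ^ n - q ^ card S) / d"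
    and q_gt_1: "q > 1" and d_pos: "d > 0"

lemma (in uniform_extensions) face_number_link:
  assumes face: "is_face L m \<sigma>"
  shows "face_number (link L \<sigma>) (-1) = 1"
    and "real (face_number (link L \<sigma>) (int i)) =
      (\<Prod>j=0..i. q ^ n - q powi (m + 1 + int j)) / (d ^ (i + 1) * fact (i + 1))"
    and "int i > int n - m - 2 \<Longrightarrow> face_number (link L \<sigma>) (int i) = 0"
proof -
  have \<sigma>: "\<sigma> \<in> L" and m: "m + 1 = int (card \<sigma>)"
    using face by (auto simp: is_face_def)
  \<comment> \<open>Counting by vertices shifts dimension by one; \<open>k = 0\<close> covers the
    empty face.\<close>
  have "face_number (link L \<sigma>) (int k - 1) = card {\<tau> \<in> link L \<sigma>. card \<tau> = k}" for k
    by (simp add: face_number_def is_face_def)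
  then have count: "real (face_number (link L \<sigma>) (int k - 1)) * fact k
      = (\<Prod>j<k. (q ^ n - q ^ (card \<sigma> + j)) / d)" for k
    using card_link_by_extensions[OF closed ext \<sigma>] by simp
  show "face_number (link L \<sigma>) (-1) = 1"
    using count[of 0] by simp
  have "real (face_number (link L \<sigma>) (int i)) * fact (i + 1)
      = (\<Prod>j<Suc i. (q ^ n - q ^ (card \<sigma> + j)) / d)"
    using count[of "Suc i"] by simp
  also have "\<dots> = (\<Prod>j=0..i. q ^ n - q powi (m + 1 + int j)) / d ^ (i + 1)"
    by (simp only: prod_dividef prod_constant lessThan_Suc_atMost atMost_atLeast0 m
        power_int_of_nat flip: of_nat_add) simp
  finally show formula: "real (face_number (link L \<sigma>) (int i)) =
      (\<Prod>j=0..i. q ^ n - q powi (m + 1 + int j)) / (d ^ (i + 1) * fact (i + 1))"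
    using d_pos by (simp add: nonzero_eq_divide_eq mult.commute mult.left_commute
        del: fact_Suc power_Suc)
  assume i: "int i > int n - m - 2"
  \<comment> \<open>An extension count is nonnegative, which bounds the size of \<sigma> by
    \<open>n\<close>.\<close>
  have "(q ^ n - q ^ card \<sigma>) / d \<ge> 0"
    using ext[OF \<sigma>] by (metis of_nat_0_le_iff)
  then have "card \<sigma> \<le> n"
    using q_gt_1 d_pos by (simp add: zero_le_divide_iff)
  \<comment> \<open>Beyond the top dimension the product contains the factor
    \<open>q ^ n - q ^ n\<close>, at \<open>j = n - card \<sigma>\<close>.\<close>
  then have "n - card \<sigma> \<in> {0..i}" "m + 1 + int (n - card \<sigma>) = int n"
    using i m by auto
  then have "(\<Prod>j=0..i. q ^ n - q powi (m + 1 + int j)) = 0"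
    by (intro prod_zero bexI[of _ "n - card \<sigma>"]) auto
  then have "real (face_number (link L \<sigma>) (int i)) = 0"
    unfolding formula by simp
  then show "face_number (link L \<sigma>) (int i) = 0"
    by simp
qed

section \<open>Cardinalities of subspaces over a finite field\<close>

text \<open>A new independent vector \<open>b\<close> multiplies the size of the span by the size of
  the field, since every vector of the larger span is uniquely \<open>k *s b + x\<close> with
  \<open>x\<close> in the old span.\<close>

lemma card_span_independent:
  fixes B :: "('a::{field,finite} ^ 'n) set"
  assumes "vec.independent B"
  shows "card (vec.span B) = CARD('a) ^ card B"
proof -
  have "finite B" by simp
  then show ?thesis
    using assms
  proof (induction B)
    case (insert b B)
    then have b: "b \<notin> vec.span B" and B: "vec.independent B"
      by (auto simp: vec.independent_insert)
    let ?f = "\<lambda>(k, x). k *s b + x"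
    have "inj_on ?f (UNIV \<times> vec.span B)"
    proof (rule inj_onI, clarify)
      fix k l x y
      assume x: "x \<in> vec.span B" and y: "y \<in> vec.span B" and eq: "k *s b + x = l *s b + y"
      have "(k - l) *s b = y - x"
        using eq by (simp add: vec.scale_left_diff_distrib algebra_simps)
      then have "(k - l) *s b \<in> vec.span B"
        using x y by (simp add: vec.span_diff)
      \<comment> \<open>The scalar is 1 unless \<open>k = l\<close>, and 1 would put
        \<open>b\<close> into the span of \<open>B\<close>.\<close>
      then have "(inverse (k - l) * (k - l)) *s b \<in> vec.span B"
        by (metis vec.span_scale vec.scale_scale)
      then have "k = l"
        using b by (metis left_inverse right_minus_eq vec.scale_one)
      then show "k = l \<and> x = y"
        using eq by simp
    qed
    moreover have "vec.span (insert b B) = ?f ` (UNIV \<times> vec.span B)"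
    proof (intro equalityI subsetI)
      fix x
      assume "x \<in> vec.span (insert b B)"
      then obtain k where "x - k *s b \<in> vec.span B"
        by (auto simp: vec.span_insert)
      then show "x \<in> ?f ` (UNIV \<times> vec.span B)"
        by (intro image_eqI[of _ _ "(k, x - k *s b)"]) auto
    next
      show "x \<in> vec.span (insert b B)" if "x \<in> ?f ` (UNIV \<times> vec.span B)" for x
        using that by (auto simp: vec.span_insert) (metis add_diff_cancel_left')
    qed
    ultimately show ?case
      using insert B by (simp add: card_image card_cartesian_product)
  qed simp
qed

lemma card_subspace:
  fixes W :: "('a::{field,finite} ^ 'n) set"
  assumes "vec.subspace W"
  shows "card W = CARD('a) ^ vec.dim W"
proof -
  obtain B where "B \<subseteq> W" "vec.independent B" "W \<subseteq> vec.span B" "card B = vec.dim W"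
    using vec.basis_exists by blast
  then show ?thesis
    using card_span_independent vec.span_minimal[OF _ assms] by (metis subset_antisym)
qed

lemma card_Compl_span:
  fixes S :: "('a::{field,finite} ^ 'n) set"
  shows "real (card (- vec.span S)) = real CARD('a) ^ CARD('n) - real CARD('a) ^ vec.dim S"
  using card_mono[of UNIV "vec.span S"]
  by (simp add: Compl_eq_Diff_UNIV card_Diff_subset card_subspace[OF vec.subspace_span] of_nat_diff)

section \<open>Extensions in the complex of independent sets\<close>

lemma independence_complex_closed:
  "insert v S \<in> independence_complex \<Longrightarrow> S \<in> independence_complex"
  by (auto simp: independence_complex_def dest: vec.independent_mono)

lemma card_extensions_independence_complex:
  fixes S :: "('a::{field,finite} ^ 'n) set"
  assumes "S \<in> independence_complex"
  shows "real (card {v. v \<notin> S \<and> insert v S \<in> independence_complex})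
    = real CARD('a) ^ CARD('n) - real CARD('a) ^ card S"
proof -
  have S: "vec.independent S"
    using assms by (simp add: independence_complex_def)
  have "{v. v \<notin> S \<and> insert v S \<in> independence_complex} = - vec.span S"
    using S by (auto simp: independence_complex_def vec.independent_insert intro: vec.span_base)
  then show ?thesis
    using S by (simp add: card_Compl_span vec.dim_eq_card_independent)
qed

section \<open>Lines and extensions in the line complex\<close>

lemma lineE:
  fixes l :: "('a::field ^ 'n) set"
  assumes "l \<in> lines"
  obtains v where "v \<noteq> 0" "l = vec.span {v}"
proof -
  have l: "vec.subspace l" "vec.dim l = 1"
    using assms by (auto simp: lines_def)
  obtain B where B: "B \<subseteq> l" "vec.independent B" "l \<subseteq> vec.span B" "card B = vec.dim l"
    using vec.basis_exists by blast
  then obtain v where "B = {v}"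
    using l by (metis card_1_singletonE)
  then show thesis
    using that[of v] B vec.span_minimal[OF _ l(1), of B] by auto
qed

lemma span_in_lines: "v \<noteq> 0 \<Longrightarrow> vec.span {v} \<in> lines"
  for v :: "'a::field ^ 'n"
  by (simp add: lines_def vec.dim_eq_card_independent)

text \<open>An inclusion of one-dimensional subspaces is an equality. Hence distinct lines share
  only 0.\<close>

lemma line_eq_span:
  fixes l :: "('a::field ^ 'n) set"
  assumes "l \<in> lines" "v \<in> l" "v \<noteq> 0"
  shows "l = vec.span {v}"
proof (rule sym, rule vec.subspace_dim_equal)
  show "vec.span {v} \<subseteq> l"
    using assms by (intro vec.span_minimal) (auto simp: lines_def)
qed (use assms span_in_lines[of v] in \<open>auto simp: lines_def\<close>)

text \<open>A line not contained in \<open>W\<close> meets it only in 0, so the nonzero vectors of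
  these lines partition the complement of \<open>W\<close>, each line contributing the field size
  minus one.\<close>

lemma card_lines_not_subset:
  fixes W :: "('a::{field,finite} ^ 'n) set"
  assumes W: "vec.subspace W"
  shows "real (card {l \<in> lines. \<not> l \<subseteq> W}) * (real CARD('a) - 1) = real (card (- W))"
proof -
  let ?N = "{l \<in> lines. \<not> l \<subseteq> W}"
  have line_sub: "l \<subseteq> W" if "l \<in> lines" "v \<in> l" "v \<noteq> 0" "v \<in> W" for l v
    using line_eq_span[OF that(1-3)] vec.span_minimal[OF _ W] that(4) by auto
  have nz: "0 \<in> W"
    using W by (rule vec.subspace_0)
  have "- W = (\<Union>l\<in>?N. l - {0})"
  proof (intro equalityI subsetI)
    fix v
    assume "v \<in> - W"
    then have "v \<noteq> 0" "v \<notin> W"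
      using nz by auto
    then show "v \<in> (\<Union>l\<in>?N. l - {0})"
      using span_in_lines[of v] vec.span_base[of v "{v}"] by blast
  qed (use line_sub in auto)
  moreover have "card (\<Union>l\<in>?N. l - {0}) = (\<Sum>l\<in>?N. card (l - {0}))"
  proof (rule card_UN_disjoint)
    show "\<forall>k\<in>?N. \<forall>l\<in>?N. k \<noteq> l \<longrightarrow> (k - {0}) \<inter> (l - {0}) = {}"
      using line_eq_span by blast
  qed auto
  moreover have "card (l - {0}) = CARD('a) - 1" if "l \<in> ?N" for l
    using that by (auto simp: lines_def card_subspace vec.subspace_0)
  ultimately show ?thesis
    by (simp add: of_nat_diff Suc_le_eq)
qed

text \<open>Adjoining a line changes the span exactly as adjoining a single generator of it
  does.\<close>

lemma dim_Union_insert_line: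
  fixes l :: "('a::field ^ 'n) set"
  assumes "l \<in> lines"
  shows "vec.dim (\<Union>(insert l S)) =
    (if l \<subseteq> vec.span (\<Union>S) then vec.dim (\<Union>S) else vec.dim (\<Union>S) + 1)"
proof -
  obtain v where v: "l = vec.span {v}"
    using assms lineE by blast
  have "vec.span (\<Union>(insert l S)) = vec.span (insert v (\<Union>S))"
    by (simp only: v Union_insert insert_is_Un[of v "\<Union>S"] vec.span_Un vec.span_span)
  then have "vec.dim (\<Union>(insert l S)) = vec.dim (insert v (\<Union>S))"
    by (metis vec.dim_span)
  moreover have "l \<subseteq> vec.span (\<Union>S) \<longleftrightarrow> v \<in> vec.span (\<Union>S)"
    unfolding v by (meson empty_subsetI insert_subset vec.span_base singletonI subsetD
        vec.span_minimal vec.subspace_span)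
  ultimately show ?thesis
    by (simp add: vec.dim_insert)
qed

lemma dim_Union_lines_le:
  fixes S :: "('a::field ^ 'n) set set"
  assumes "finite S" "S \<subseteq> lines"
  shows "vec.dim (\<Union>S) \<le> card S"
  using assms
proof (induction S)
  case (insert l S)
  then show ?case
    using dim_Union_insert_line[of l S] by (auto split: if_splits)
qed simp

text \<open>The dimension grows by at most one with the new line and is at most
  \<open>card S\<close> before. Reaching \<open>card S + 1\<close> therefore forces equality in both
  bounds.\<close>

lemma line_complex_insert:
  fixes S :: "('a::field ^ 'n) set set"
  assumes "l \<notin> S"
  shows "insert l S \<in> line_complex \<longleftrightarrow>
    S \<in> line_complex \<and> l \<in> lines \<and> \<not> l \<subseteq> vec.span (\<Union>S)"
proof (cases "finite S \<and> insert l S \<subseteq> lines")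
  case True
  then show ?thesis
    using assms dim_Union_insert_line[of l S] dim_Union_lines_le[of S]
    by (auto simp: line_complex_def simp del: Union_insert)
qed (auto simp: line_complex_def)

lemma line_complex_closed: "insert l S \<in> line_complex \<Longrightarrow> S \<in> line_complex"
  by (cases "l \<in> S") (auto simp: line_complex_insert insert_absorb)

lemma card_extensions_line_complex:
  fixes S :: "('a::{field,finite} ^ 'n) set set"
  assumes S: "S \<in> line_complex"
  shows "real (card {l. l \<notin> S \<and> insert l S \<in> line_complex})
    = (real CARD('a) ^ CARD('n) - real CARD('a) ^ card S) / (real CARD('a) - 1)"
proof -
  \<comment> \<open>This makes \<open>l \<notin> S\<close> automatic for lines outside the
    span.\<close>
  have "l \<subseteq> vec.span (\<Union>S)" if "l \<in> S" for l
    using that by (meson Union_upper order_trans vec.span_superset)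
  then have "{l. l \<notin> S \<and> insert l S \<in> line_complex} = {l \<in> lines. \<not> l \<subseteq> vec.span (\<Union>S)}"
    using S line_complex_insert by blast
  moreover have "vec.dim (\<Union>S) = card S"
    using S by (simp add: line_complex_def)
  moreover have "CARD('a) > 1"
    using card_mono[of UNIV "{0, 1 :: 'a}"] by simp
  ultimately show ?thesis
    using card_lines_not_subset[OF vec.subspace_span, of "\<Union>S"] card_Compl_span[of "\<Union>S"]
    by (simp add: field_simps)
qed

section \<open>The f-vectors of both complexes and of their links\<close>

text \<open>The vanishing clauses complete each f-vector above the stated range. The dimension
  \<open>m\<close> is an integer so that the empty simplex, with \<open>m = -1\<close>, is included;
  for a face, the exponent \<open>m + 1 + int j\<close> is \<open>card \<sigma> + j\<close>, hence
  nonnegative.\<close>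

theorem lemma2p9:
  fixes p n :: nat
  assumes p: "p = CARD('p::prime_card)"
    and n: "n = CARD('n::finite)"
  shows
    "(let X = (independence_complex :: ('p mod_ring ^ 'n) set set) in
        face_number X (-1) = 1 \<and>
        (\<forall>i::nat. i \<le> n - 1 \<longrightarrow>
           real (face_number X (int i)) =
             (\<Prod>j=0..i. real p ^ n - real p ^ j) / fact (i + 1)) \<and>
        (\<forall>i::nat. i > n - 1 \<longrightarrow> face_number X (int i) = 0))
     \<and>
     (let K = (line_complex :: ('p mod_ring ^ 'n) set set set) in
        face_number K (-1) = 1 \<and>
        (\<forall>i::nat. i \<le> n - 1 \<longrightarrow>
           real (face_number K (int i)) =
             (\<Prod>j=0..i. real p ^ n - real p ^ j) / ((real p - 1) ^ (i + 1) * fact (i + 1))) \<and>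
        (\<forall>i::nat. i > n - 1 \<longrightarrow> face_number K (int i) = 0))
     \<and>
     (let X = (independence_complex :: ('p mod_ring ^ 'n) set set) in
        \<forall>(m::int) \<sigma>. is_face X m \<sigma> \<longrightarrow>
          face_number (link X \<sigma>) (-1) = 1 \<and>
          (\<forall>i::nat. int i \<le> int n - m - 2 \<longrightarrow>
             real (face_number (link X \<sigma>) (int i)) =
               (\<Prod>j=0..i. real p ^ n - real p powi (m + 1 + int j)) / fact (i + 1)) \<and>
          (\<forall>i::nat. int i > int n - m - 2 \<longrightarrow> face_number (link X \<sigma>) (int i) = 0))
     \<and>
     (let K = (line_complex :: ('p mod_ring ^ 'n) set set set) in
        \<forall>(m::int) \<sigma>. is_face K m \<sigma> \<longrightarrow>
          face_number (link K \<sigma>) (-1) = 1 \<and>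
          (\<forall>i::nat. int i \<le> int n - m - 2 \<longrightarrow>
             real (face_number (link K \<sigma>) (int i)) =
               (\<Prod>j=0..i. real p ^ n - real p powi (m + 1 + int j))
                 / ((real p - 1) ^ (i + 1) * fact (i + 1))) \<and>
          (\<forall>i::nat. int i > int n - m - 2 \<longrightarrow> face_number (link K \<sigma>) (int i) = 0))"
proof -
  let ?X = "independence_complex :: ('p mod_ring ^ 'n) set set"
  let ?K = "line_complex :: ('p mod_ring ^ 'n) set set set"
  have "p > 1"
    using prime_card[where 'a = 'p] p prime_gt_1_nat by blast
  then have gt: "real p > 1" "real p - 1 > 0"
    by auto
  interpret X: uniform_extensions ?X n "real p" 1
    by unfold_locales
      (use gt in \<open>auto simp: p n card_extensions_independence_complex
        dest: independence_complex_closed\<close>)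
  interpret K: uniform_extensions ?K n "real p" "real p - 1"
    by unfold_locales
      (use gt in \<open>auto simp: p n card_extensions_line_complex
        dest: line_complex_closed\<close>)
  \<comment> \<open>The link of the empty simplex is the whole complex, so the first two parts are
    the case \<open>m = -1\<close> of the last two.\<close>
  have eX: "is_face ?X (-1) {}" and eK: "is_face ?K (-1) {}"
    by (auto simp: is_face_def independence_complex_def line_complex_def vec.independent_empty)
  \<comment> \<open>The premise subtracts in the natural numbers; truncation could only raise that
    bound, so the integer inequality follows.\<close>
  have n1: "int i > int n - (-1) - 2" if "i > n - 1" for i
    using that by simp
  note X = X.face_number_link and K = K.face_number_link
  show ?thesis
    unfolding Let_def
    using X(1,2)[OF eX] X(3)[OF eX n1] K(1,2)[OF eK] K(3)[OF eK n1]
    by (intro conjI allI impI X(1,3) K) (simp_all add: X(2) del: fact_Suc power_Suc)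
qed

end
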